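(* For every integer $d \geq 4$ there exist an integer $n \geq 1$, a matrix $V \in \mathbb{R}^{d \times n}$ and vectors $w, w' \in \mathbb{R}^d$ such that the matrix $(V|w|w') \in \mathbb{R}^{d \times (n+2)}$ is 2-modular and $$|Z(V)|\,|Z(V|w|w')| > |Z(V|w)|\,|Z(V|w')|.$$
   Context: For a matrix $M = (m_1,\dots,m_k) \in \mathbb{R}^{d\times k}$ with columns $m_i$, the zonotope generated by $M$ is the Minkowski sum of the segments $[0,m_i] = \mathrm{conv}(0,m_i)$, i.e. $Z(M) = \{\sum_{i=1}^k \lambda_i m_i : \lambda_i \in [0,1]\} \subseteq \mathbb{R}^d$. The notation $(V|w)$, $(V|w')$, $(V|w|w')$ denotes the matrix obtained by appending the indicated column vectors to $V$, and $Z(V|w)$ etc. is the zonotope generated by that matrix. $|\cdot|$ denotes $d$-dimensional volume (Lebesgue measure). A matrix with $d$ rows is called 2-modular if all its $(d \times d)$-sub-determinants lie in $\{-2,-1,0,1,2\}$. *)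

theory Defs
  imports "HOL-Analysis.Analysis"
begin

text \<open>
  A real matrix with \<open>d\<close> rows and \<open>k\<close> columns is represented by the list, of length \<open>k\<close>, of its
  columns, which are vectors in \<open>real ^ 'd\<close> with \<open>d = CARD('d)\<close>.  In this way the number of columns
  is an ordinary natural number that can be quantified over, and \<open>(V|w)\<close>, \<open>(V|w|w')\<close> are
  \<open>V @ [w]\<close>, \<open>V @ [w, w']\<close>.
\<close>

type_synonym 'd col_matrix = "(real ^ 'd) list"

definition zonotope :: "'d::finite col_matrix \<Rightarrow> (real ^ 'd) set" where
  "zonotope M = {\<Sum>i<length M. c i *\<^sub>R M ! i | c :: nat \<Rightarrow> real. \<forall>i<length M. c i \<in> {0..1}}"

text \<open>
  The square submatrix of \<open>M\<close> whose \<open>j\<close>-th column is column \<open>f j\<close> of \<open>M\<close>.  A choice of \<open>d\<close> columns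
  is an injection \<open>f\<close> from \<open>'d\<close> into the column indices; as the index type \<open>'d\<close> carries no order, the
  chosen columns may appear in any order, which only affects the sign of the determinant.
\<close>

definition square_submatrix :: "'d::finite col_matrix \<Rightarrow> ('d \<Rightarrow> nat) \<Rightarrow> real ^ 'd ^ 'd" where
  "square_submatrix M f = (\<chi> i j. (M ! f j) $ i)"

definition two_modular :: "'d::finite col_matrix \<Rightarrow> bool" where
  "two_modular M \<longleftrightarrow>
    (\<forall>f :: 'd \<Rightarrow> nat. inj f \<and> range f \<subseteq> {..<length M} \<longrightarrow>
       det (square_submatrix M f) \<in> {-2, -1, 0, 1, 2})"

end

theory Submission
  imports Defs
begin

text \<open>
  The volume of a zonotope in \<open>\<real>\<^sup>d\<close> is the sum of \<open>\<bar>det\<bar>\<close> over all choices of \<open>d\<close> generators.  To see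
  this, fix a generic linear cost on the coefficients.  Almost every point of the zonotope has an
  optimal representation whose coefficients lie strictly between \<open>0\<close> and \<open>1\<close> exactly on a basis \<open>B\<close>,
  the others being \<open>0\<close> or \<open>1\<close> according to the sign of their reduced costs.  Hence the zonotope is, up
  to a null set, the disjoint union of one translated open parallelepiped for every basis.

  For generators consisting of the unit vectors and the columns of a matrix \<open>A\<close>, the \<open>d \<times> d\<close>
  determinants are, up to sign, the minors of \<open>A\<close> of all sizes, so rows of zeros do not matter and
  the dimension \<open>4\<close> is sufficient.  There, \<open>V = (I|a|b)\<close> with \<open>a = (0,1,-1,1)\<close>, \<open>b = (1,0,1,1)\<close>,
  \<open>w = (1,1,0,1)\<close>, \<open>w' = (0,0,1,1)\<close>, found by a computer search, gives
  \<open>14 \<cdot> 56 = 784 > 780 = 26 \<cdot> 30\<close>.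
\<close>

subsection \<open>Zonotopes as sets of feasible points\<close>

text \<open>Generators are indexed by a set, so that a basis is a subset of \<open>I\<close> and
  equal generators at different indices stay apart. The ambient space is arbitrary because the
  generators are later paired with their costs.\<close>

definition zonotope_on :: "('i \<Rightarrow> 'v::real_vector) \<Rightarrow> 'i set \<Rightarrow> 'v set" where
  "zonotope_on m I = {\<Sum>i\<in>I. c i *\<^sub>R m i | c. \<forall>i\<in>I. c i \<in> {0..1::real}}"

lemma zonotope_on_insert:
  assumes "finite I" "i \<notin> I"
  shows "zonotope_on m (insert i I) = {x + y | x y. x \<in> zonotope_on m I \<and> y \<in> closed_segment 0 (m i)}"
proof -
  have "(\<exists>x y. v = x + y \<and> x \<in> zonotope_on m I \<and> y \<in> closed_segment 0 (m i))" if v: "v \<in> zonotope_on m (insert i I)" for v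
  proof -
    obtain c where c: "v = (\<Sum>j\<in>insert i I. c j *\<^sub>R m j)" "\<forall>j\<in>insert i I. c j \<in> {0..1::real}"
      using v unfolding zonotope_on_def by blast
    have "(\<Sum>j\<in>I. c j *\<^sub>R m j) \<in> zonotope_on m I" "c i *\<^sub>R m i \<in> closed_segment 0 (m i)"
      using c(2) unfolding zonotope_on_def closed_segment_def by auto
    then show ?thesis using c(1) assms by (metis add.commute sum.insert)
  qed
  moreover have "v \<in> zonotope_on m (insert i I)"
    if xy: "v = x + y" "x \<in> zonotope_on m I" "y \<in> closed_segment 0 (m i)" for v x y
  proof -
    obtain c u where c: "x = (\<Sum>i\<in>I. c i *\<^sub>R m i)" "\<forall>i\<in>I. c i \<in> {0..1::real}"
      and u: "y = u *\<^sub>R m i" "u \<in> {0..1}"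
      using xy(2,3) unfolding zonotope_on_def closed_segment_def by auto
    have "(\<Sum>j\<in>I. (c(i:=u)) j *\<^sub>R m j) = (\<Sum>j\<in>I. c j *\<^sub>R m j)"
      by (rule sum.cong) (use assms in auto)
    then have "v = (\<Sum>j\<in>insert i I. (c(i:=u)) j *\<^sub>R m j)"
      using assms c u xy by (simp add: add.commute)
    then show ?thesis unfolding zonotope_on_def using c u by (intro CollectI exI[of _ "c(i:=u)"]) auto
  qed
  ultimately show ?thesis by blast
qed

lemma compact_zonotope_on:
  fixes m :: "'i \<Rightarrow> 'v::real_normed_vector"
  assumes "finite I"
  shows "compact (zonotope_on m I)"
  using assms
proof (induction I rule: finite_induct)
  case empty
  then show ?case by (simp add: zonotope_on_def)
next
  case (insert i I)
  then show ?case using compact_sums[OF insert.IH compact_segment[of 0 "m i"]]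
    by (simp add: zonotope_on_insert)
qed

text \<open>The minimum is attained since the pairs of a point and its cost form a zonotope as well.\<close>

lemma optimal_coefficients:
  fixes m :: "'i \<Rightarrow> 'v::real_normed_vector" and c :: "'i \<Rightarrow> real"
  assumes "finite I" "x \<in> zonotope_on m I"
  obtains l where "\<forall>i\<in>I. l i \<in> {0..1::real}" "x = (\<Sum>i\<in>I. l i *\<^sub>R m i)"
    "\<And>k. \<forall>i\<in>I. k i \<in> {0..1} \<Longrightarrow> x = (\<Sum>i\<in>I. k i *\<^sub>R m i) \<Longrightarrow>
       (\<Sum>i\<in>I. l i * c i) \<le> (\<Sum>i\<in>I. k i * c i)"
proof -
  define P where "P = zonotope_on (\<lambda>i. (m i, c i)) I"
  have P: "P = {((\<Sum>i\<in>I. k i *\<^sub>R m i), (\<Sum>i\<in>I. k i * c i)) | k. \<forall>i\<in>I. k i \<in> {0..1}}"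
    unfolding P_def zonotope_on_def by (simp add: sum_prod)
  have "compact (P \<inter> ({x} \<times> UNIV))"
    unfolding P_def by (intro compact_Int_closed compact_zonotope_on assms closed_Times) auto
  then have cp: "compact (snd ` (P \<inter> ({x} \<times> UNIV)))"
    by (intro compact_continuous_image continuous_intros)
  have ne: "snd ` (P \<inter> ({x} \<times> UNIV)) \<noteq> {}"
    using assms(2) unfolding P zonotope_on_def by auto
  obtain s where s: "s \<in> snd ` (P \<inter> ({x} \<times> UNIV))"
    "\<And>t. t \<in> snd ` (P \<inter> ({x} \<times> UNIV)) \<Longrightarrow> s \<le> t"
    using compact_attains_inf[OF cp ne] by blast
  obtain l where l: "\<forall>i\<in>I. l i \<in> {0..1::real}" "x = (\<Sum>i\<in>I. l i *\<^sub>R m i)"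
    "s = (\<Sum>i\<in>I. l i * c i)"
    using s(1) unfolding P by auto
  show ?thesis
  proof (rule that[OF l(1,2)])
    fix k :: "'i \<Rightarrow> real"
    assume k: "\<forall>i\<in>I. k i \<in> {0..1}" "x = (\<Sum>i\<in>I. k i *\<^sub>R m i)"
    have "(x, \<Sum>i\<in>I. k i * c i) \<in> P" unfolding P using k by blast
    then have "(\<Sum>i\<in>I. k i * c i) \<in> snd ` (P \<inter> ({x} \<times> UNIV))" by force
    then show "(\<Sum>i\<in>I. l i * c i) \<le> (\<Sum>i\<in>I. k i * c i)" using s(2) l(3) by simp
  qed
qed

text \<open>Induction on \<open>I\<close>: given the costs already chosen, a vector \<open>v\<close>
  with \<open>v i \<noteq> 0\<close> forbids a single value for the cost of \<open>i\<close>, and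
  finitely many vectors leave a value free. If \<open>v i = 0\<close>, the earlier costs
  suffice.\<close>

lemma generic_cost:
  fixes W :: "('i \<Rightarrow> real) set"
  assumes "finite I" "finite W"
  shows "\<exists>c::'i \<Rightarrow> real. \<forall>v\<in>W. (\<exists>i\<in>I. v i \<noteq> 0) \<longrightarrow> (\<Sum>i\<in>I. v i * c i) \<noteq> 0"
  using assms(1)
proof (induction I rule: finite_induct)
  case empty
  then show ?case by simp
next
  case (insert i I)
  then obtain c :: "'i \<Rightarrow> real"
    where c: "\<And>v. v \<in> W \<Longrightarrow> \<exists>i\<in>I. v i \<noteq> 0 \<Longrightarrow> (\<Sum>i\<in>I. v i * c i) \<noteq> 0"
    by blast
  obtain t where t: "t \<notin> (\<lambda>v. - (\<Sum>i\<in>I. v i * c i) / v i) ` W"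
    using ex_new_if_finite[OF infinite_UNIV_char_0] assms(2) by blast
  have "(\<Sum>j\<in>insert i I. v j * (c(i:=t)) j) \<noteq> 0" if v: "v \<in> W" "\<exists>j\<in>insert i I. v j \<noteq> 0" for v
  proof -
    have "(\<Sum>j\<in>I. v j * (c(i:=t)) j) = (\<Sum>j\<in>I. v j * c j)"
      by (rule sum.cong) (use insert in auto)
    then have *: "(\<Sum>j\<in>insert i I. v j * (c(i:=t)) j) = v i * t + (\<Sum>j\<in>I. v j * c j)"
      using insert by simp
    show ?thesis
    proof (cases "v i = 0")
      case True
      then show ?thesis using * c v by auto
    next
      case False
      have "t \<noteq> - (\<Sum>i\<in>I. v i * c i) / v i" using t v by blast
      then show ?thesis using * False by (auto simp: field_simps)
    qed
  qed
  then show ?case by blast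
qed

section \<open>Bases as index sets and their determinants\<close>

definition sel_matrix :: "('i \<Rightarrow> real ^ 'd) \<Rightarrow> ('d \<Rightarrow> 'i) \<Rightarrow> real ^ 'd ^ 'd" where
  "sel_matrix m g = (\<chi> i j. m (g j) $ i)"

text \<open>An index set has no order, so an arbitrary enumeration is chosen; another one permutes
  the columns and changes at most the sign. The value is meaningful only if
  \<open>card B = CARD('d)\<close>, so that an enumeration exists.\<close>

definition abs_det :: "('i \<Rightarrow> real ^ 'd) \<Rightarrow> 'i set \<Rightarrow> real" where
  "abs_det m B = \<bar>det (sel_matrix m (SOME g. bij_betw g (UNIV :: 'd set) B))\<bar>"

lemma abs_det_eq:
  fixes m :: "'i \<Rightarrow> real ^ 'd"
  assumes g: "bij_betw g (UNIV :: 'd set) B"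
  shows "abs_det m B = \<bar>det (sel_matrix m g)\<bar>"
proof -
  define h where "h = (SOME g. bij_betw g (UNIV :: 'd set) B)"
  have h: "bij_betw h UNIV B" unfolding h_def using g by (rule someI[where P="\<lambda>g. bij_betw g UNIV B"])
  define p where "p = inv_into UNIV g \<circ> h"
  have "bij_betw p UNIV UNIV"
    unfolding p_def using bij_betw_trans[OF h bij_betw_inv_into[OF g]] .
  then have p: "p permutes UNIV" by (simp add: permutes_def bij_iff)
  have gp: "g (p j) = h j" for j
    unfolding p_def using bij_betw_inv_into_right[OF g] h bij_betwE by fastforce
  have "sel_matrix m h = (\<chi> i j. sel_matrix m g $ i $ p j)"
    by (simp add: sel_matrix_def gp)
  then have "det (sel_matrix m h) = of_int (sign p) * det (sel_matrix m g)"
    using det_permute_columns[OF p, of "sel_matrix m g"] by simp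
  then have "\<bar>det (sel_matrix m h)\<bar> = \<bar>det (sel_matrix m g)\<bar>"
    by (simp add: abs_mult sign_def)
  then show ?thesis unfolding abs_det_def h_def .
qed

lemma sel_matrix_mult:
  fixes m :: "'i \<Rightarrow> real ^ 'd"
  shows "sel_matrix m g *v x = (\<Sum>j\<in>UNIV. x $ j *\<^sub>R m (g j))"
  by (simp add: vec_eq_iff matrix_vector_mult_def sel_matrix_def mult.commute)

lemma sum_bij_UNIV:
  assumes "bij_betw g UNIV B"
  shows "(\<Sum>j\<in>UNIV. f (g j)) = (\<Sum>i\<in>B. f i)"
  using sum.reindex_bij_betw[OF assms] .

lemma ex_bij_UNIV:
  assumes "finite B" "card B = CARD('d::finite)"
  obtains g where "bij_betw g (UNIV :: 'd set) B"
  using finite_same_card_bij[of "UNIV :: 'd set" B] assms by auto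

definition basis_set :: "('i \<Rightarrow> real ^ 'd) \<Rightarrow> 'i set \<Rightarrow> bool" where
  "basis_set m B \<longleftrightarrow> finite B \<and> card B = CARD('d) \<and> abs_det m B \<noteq> 0"

lemma basis_set_bij:
  fixes m :: "'i \<Rightarrow> real ^ 'd"
  assumes "basis_set m B"
  obtains g where "bij_betw g (UNIV :: 'd set) B" "invertible (sel_matrix m g)"
    "abs_det m B = \<bar>det (sel_matrix m g)\<bar>"
  using assms ex_bij_UNIV[of B, where 'd='d] unfolding basis_set_def
  by (metis abs_det_eq abs_eq_0 invertible_det_nz)

lemma basis_set_expand:
  fixes m :: "'i \<Rightarrow> real ^ 'd"
  assumes "basis_set m B"
  obtains a where "v = (\<Sum>b\<in>B. a b *\<^sub>R m b)"
proof -
  obtain g where g: "bij_betw g (UNIV :: 'd set) B" "invertible (sel_matrix m g)"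
    by (rule basis_set_bij[OF assms])
  obtain S' where S': "sel_matrix m g ** S' = mat 1" using g(2) unfolding invertible_def by blast
  define x where "x = S' *v v"
  have "sel_matrix m g *v x = v"
    unfolding x_def using S' by (simp add: matrix_vector_mul_assoc)
  then have "v = (\<Sum>j\<in>UNIV. x $ j *\<^sub>R m (g j))" by (simp add: sel_matrix_mult)
  also have "\<dots> = (\<Sum>j\<in>UNIV. (\<lambda>b. x $ inv_into UNIV g b *\<^sub>R m b) (g j))"
    using bij_betw_imp_inj_on[OF g(1)] by (intro sum.cong) auto
  also have "\<dots> = (\<Sum>b\<in>B. x $ inv_into UNIV g b *\<^sub>R m b)" by (rule sum_bij_UNIV[OF g(1)])
  finally show ?thesis by (rule that[of "\<lambda>b. x $ inv_into UNIV g b"])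
qed

text \<open>The vector \<open>y\<close> is the dual solution of the linear programme at the basis
  \<open>B\<close>: the reduced costs \<open>c b - y \<bullet> m b\<close> vanish on
  \<open>B\<close>. It solves the transposed system, which is invertible along with the
  matrix.\<close>

lemma basis_set_dual:
  fixes m :: "'i \<Rightarrow> real ^ 'd" and c :: "'i \<Rightarrow> real"
  assumes "basis_set m B"
  shows "\<exists>y. \<forall>b\<in>B. y \<bullet> m b = c b"
proof -
  obtain g where g: "bij_betw g (UNIV :: 'd set) B" "invertible (sel_matrix m g)"
    by (rule basis_set_bij[OF assms])
  define S where "S = sel_matrix m g"
  have i: "invertible (transpose S)" using g(2) transpose_invertible S_def by blast
  then obtain S' where S': "transpose S ** S' = mat 1" unfolding invertible_def by blast
  define y where "y = S' *v (\<chi> j. c (g j))"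
  have "transpose S *v y = (\<chi> j. c (g j))"
    unfolding y_def using S' by (simp add: matrix_vector_mul_assoc)
  then have "(transpose S *v y) $ j = c (g j)" for j by simp
  then have "y \<bullet> m (g j) = c (g j)" for j
    by (simp add: matrix_vector_mult_def transpose_def S_def sel_matrix_def inner_vec_def mult.commute)
  then show ?thesis using g(1) unfolding bij_betw_def by blast
qed

lemma independent_is_basis_set:
  fixes m :: "'i \<Rightarrow> real ^ 'd"
  assumes "finite F" "card F = CARD('d)"
    and ind: "\<And>v. (\<Sum>i\<in>F. v i *\<^sub>R m i) = 0 \<Longrightarrow> \<forall>i\<in>F. v i = 0"
  shows "basis_set m F"
proof -
  obtain g where g: "bij_betw g (UNIV :: 'd set) F" by (rule ex_bij_UNIV[OF assms(1,2)])
  have inj: "inj g" using g by (rule bij_betw_imp_inj_on)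
  have "x = 0" if "sel_matrix m g *v x = 0" for x
  proof -
    have "0 = (\<Sum>j\<in>UNIV. x $ j *\<^sub>R m (g j))" using that by (simp add: sel_matrix_mult)
    also have "\<dots> = (\<Sum>j\<in>UNIV. (\<lambda>b. x $ inv_into UNIV g b *\<^sub>R m b) (g j))"
      using inj by (intro sum.cong) auto
    also have "\<dots> = (\<Sum>b\<in>F. x $ inv_into UNIV g b *\<^sub>R m b)" by (rule sum_bij_UNIV[OF g])
    finally have "\<forall>b\<in>F. x $ inv_into UNIV g b = 0" using ind by metis
    then have "x $ j = 0" for j using g inj by (metis UNIV_I bij_betwE inv_into_f_f)
    then show ?thesis by (simp add: vec_eq_iff)
  qed
  then have "invertible (sel_matrix m g)"
    using matrix_left_invertible_ker invertible_left_inverse by blast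
  then show ?thesis
    unfolding basis_set_def using assms(1,2) abs_det_eq[OF g, of m] by (simp add: invertible_det_nz)
qed

text \<open>Otherwise \<open>CARD('d)\<close> of the indices would form a basis, and expanding one
  further generator in it would give a nontrivial relation.\<close>

lemma independent_card_le:
  fixes m :: "'i \<Rightarrow> real ^ 'd"
  assumes "finite F"
    and ind: "\<And>v. (\<Sum>i\<in>F. v i *\<^sub>R m i) = 0 \<Longrightarrow> \<forall>i\<in>F. v i = 0"
  shows "card F \<le> CARD('d)"
proof (rule ccontr)
  assume "\<not> card F \<le> CARD('d)"
  then obtain B where B: "B \<subseteq> F" "card B = CARD('d)" "finite B" "B \<noteq> F"
    using obtain_subset_with_card_n[of "CARD('d)" F] by (metis nat_le_linear order_refl)
  have ext: "(\<Sum>i\<in>F. (if i \<in> B then v i else 0) *\<^sub>R m i) = (\<Sum>i\<in>B. v i *\<^sub>R m i)" for v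
    by (rule sum.mono_neutral_cong_right) (use B assms in auto)
  obtain j where j: "j \<in> F" "j \<notin> B" using B by blast
  have "basis_set m B"
  proof (rule independent_is_basis_set)
    show "\<forall>i\<in>B. v i = 0" if "(\<Sum>i\<in>B. v i *\<^sub>R m i) = 0" for v
      using ind[of "\<lambda>i. if i \<in> B then v i else 0"] that ext[of v] B(1) by (metis subsetD)
  qed (use B in auto)
  then obtain a where a: "m j = (\<Sum>b\<in>B. a b *\<^sub>R m b)" by (rule basis_set_expand)
  define v where "v i = (if i \<in> B then a i else 0) - (if i = j then 1 else 0)" for i
  have "(\<Sum>i\<in>F. v i *\<^sub>R m i) = 0"
    unfolding v_def scaleR_diff_left sum_subtractf ext a[symmetric]
    using assms(1) j by (simp add: if_distrib[of "\<lambda>c. c *\<^sub>R _"] sum.delta cong: if_cong)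
  then have "v j = 0" using ind j by blast
  then show False using j unfolding v_def by simp
qed

subsection \<open>Linear images and parallelepipeds\<close>

text \<open>Unlike \<open>measure_linear_image\<close>, without a wellorder on the index type.\<close>

lemma measure_matrix_image:
  fixes A :: "real ^ 'n ^ 'n"
  assumes "S \<in> lmeasurable"
  shows "(*v) A ` S \<in> lmeasurable \<and> measure lebesgue ((*v) A ` S) = \<bar>det A\<bar> * measure lebesgue S"
proof -
  define P where "P A \<longleftrightarrow> (\<forall>S\<in>lmeasurable. (*v) A ` S \<in> lmeasurable \<and>
      measure lebesgue ((*v) A ` S) = \<bar>det A\<bar> * measure lebesgue S)" for A :: "real ^ 'n ^ 'n"
  \<comment> \<open>This serves the swaps and shears, for which only the images of boxes need to be
    measured.\<close>
  have boxes: "P A" if "\<bar>det A\<bar> = 1" "\<And>a b. cbox a b \<noteq> {} \<Longrightarrow>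
      measure lebesgue ((*v) A ` cbox a b) = measure lebesgue (cbox a b)" for A
  proof -
    have "measure lebesgue ((*v) A ` cbox a b) = 1 * measure lebesgue (cbox a b)" for a b
      using that(2)[of a b] by (cases "cbox a b = {}") auto
    then have "(*v) A ` S \<in> lmeasurable \<and> measure lebesgue ((*v) A ` S) = 1 * measure lebesgue S"
      if "S \<in> lmeasurable" for S
      using measure_linear_sufficient[OF matrix_vector_mul_linear that, of A 1] by simp
    then show ?thesis unfolding P_def that(1) by auto
  qed
  have "P A"
  proof (rule induct_matrix_elementary_alt[of P])
    show "P (A ** B)" if "P A" "P B" for A B
      unfolding P_def
    proof
      fix S :: "(real ^ 'n) set" assume "S \<in> lmeasurable"
      then show "(*v) (A ** B) ` S \<in> lmeasurable \<and>
        measure lebesgue ((*v) (A ** B) ` S) = \<bar>det (A ** B)\<bar> * measure lebesgue S"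
        using that unfolding P_def matrix_vector_mult_matrix_matrix_mult_compose image_comp[symmetric]
        by (simp add: det_mul abs_mult)
    qed
  next
    fix A :: "real ^ 'n ^ 'n" and i
    assume "row i A = 0"
    then have d: "det A = 0" by (rule det_zero_row)
    then have "\<not> inj ((*v) A)"
      using det_nz_iff_inj[OF matrix_vector_mul_linear[of A]] by simp
    then have "negligible ((*v) A ` S)" for S
      by (rule negligible_linear_singular_image[OF matrix_vector_mul_linear])
    then show "P A" unfolding P_def using d by (simp add: negligible_iff_measure)
  next
    fix A :: "real ^ 'n ^ 'n"
    assume A: "\<And>i j. i \<noteq> j \<Longrightarrow> A $ i $ j = 0"
    have "A *v x = (\<chi> k. A $ k $ k * x $ k)" for x
    proof -
      have "(\<Sum>j\<in>UNIV. A $ k $ j * x $ j) = (\<Sum>j\<in>{k}. A $ k $ j * x $ j)" for k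
        using A by (intro sum.mono_neutral_right) auto
      then show ?thesis by (simp add: matrix_vector_mult_def)
    qed
    then have "(*v) A = (\<lambda>x. \<chi> k. A $ k $ k * x $ k)" by blast
    then show "P A"
      unfolding P_def by (simp add: measurable_stretch measure_stretch det_diagonal[OF A])
  next
    fix m n :: 'n
    assume "m \<noteq> n"
    let ?s = "Transposition.transpose m n"
    let ?A = "(\<chi> i j. mat 1 $ i $ ?s j) :: real ^ 'n ^ 'n"
    have A: "?A *v x = (\<chi> i. x $ ?s i)" for x
    proof -
      have "(\<Sum>j\<in>UNIV. (if i = ?s j then 1 else 0) * x $ j) = (\<Sum>j\<in>UNIV. if j = ?s i then x $ j else 0)" for i
        by (intro sum.cong) (auto simp: transpose_eq_iff)
      then show ?thesis by (simp add: matrix_vector_mult_def mat_def vec_eq_iff)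
    qed
    show "P ?A"
    proof (rule boxes)
      show "\<bar>det ?A\<bar> = 1"
        by (subst det_permute_columns) (simp_all add: permutes_swap_id abs_mult sign_def)
      fix a b :: "real ^ 'n"
      assume ne: "cbox a b \<noteq> {}"
      have "(*v) ?A ` cbox a b = cbox (?A *v a) (?A *v b)"
      proof (intro equalityI subsetI)
        fix x assume "x \<in> cbox (?A *v a) (?A *v b)"
        then have "a $ i \<le> x $ ?s i \<and> x $ ?s i \<le> b $ i" for i
          unfolding A mem_box_cart by (metis transpose_involutory vec_lambda_beta)
        then have "?A *v x \<in> cbox a b" unfolding A mem_box_cart by simp
        moreover have "x = ?A *v (?A *v x)" unfolding A by (simp add: vec_eq_iff)
        ultimately show "x \<in> (*v) ?A ` cbox a b" by (rule image_eqI[rotated])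
      qed (auto simp: A mem_box_cart)
      moreover have "(\<Prod>i\<in>UNIV. b $ ?s i - a $ ?s i) = (\<Prod>i\<in>UNIV. b $ i - a $ i)"
        using prod.permute[OF permutes_swap_id[of m UNIV n], of "\<lambda>i. b $ i - a $ i"] by (simp add: o_def)
      moreover have "cbox (?A *v a) (?A *v b) \<noteq> {}" using ne calculation(1) by blast
      ultimately show "measure lebesgue ((*v) ?A ` cbox a b) = measure lebesgue (cbox a b)"
        using ne by (simp add: content_cbox_cart A)
    qed
  next
    fix m n :: 'n
    assume mn: "m \<noteq> n"
    let ?A = "(\<chi> i j. of_bool (i = m \<and> j = n \<or> i = j)) :: real ^ 'n ^ 'n"
    have A: "?A *v x = (\<chi> i. if i = m then x $ m + x $ n else x $ i)" for x
    proof -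
      have "(\<Sum>j\<in>UNIV. of_bool (i = m \<and> j = n \<or> i = j) * x $ j) =
          (\<Sum>j\<in>(if i = m then {m, n} else {i}). x $ j)" for i
        by (intro sum.mono_neutral_cong_right) (auto split: if_splits)
      then show ?thesis using mn by (auto simp: matrix_vector_mult_def vec_eq_iff)
    qed
    have "?A = (\<chi> k. if k = m then row m (mat 1) + 1 *s row n (mat 1) else row k (mat 1))"
      using mn by (auto simp: vec_eq_iff row_def mat_def)
    then have "det ?A = 1" using det_row_operation[OF mn, of "mat 1" 1] by simp
    show "P ?A"
    proof (rule boxes)
      show "\<bar>det ?A\<bar> = 1" using \<open>det ?A = 1\<close> by simp
      fix a b :: "real ^ 'n"
      assume ne: "cbox a b \<noteq> {}"
      \<comment> \<open>The shear formula for boxes requires a nonnegative lower bound in coordinate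
        \<open>n\<close>; translating by \<open>v\<close> moves that bound to
        \<open>0\<close>.\<close>
      define v where "v = axis n (a $ n)"
      have box: "cbox a b = (+) v ` cbox (a - v) (b - v)"
        using cbox_translation[of v "a - v" "b - v"] by simp
      have "(*v) ?A ` cbox a b = (+) (?A *v v) ` (*v) ?A ` cbox (a - v) (b - v)"
        unfolding box image_image by (simp add: matrix_vector_right_distrib)
      also have "measure lebesgue \<dots> = measure lebesgue ((*v) ?A ` cbox (a - v) (b - v))"
        by (rule measure_translation)
      also have "\<dots> = measure lebesgue (cbox (a - v) (b - v))"
      proof -
        have "cbox (a - v) (b - v) \<noteq> {}" using ne unfolding box by blast
        moreover have "0 \<le> (a - v) $ n" by (simp add: v_def)
        ultimately show ?thesis using measure_shear_interval[OF mn] unfolding A by blast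
      qed
      also have "\<dots> = measure lebesgue (cbox a b)"
        unfolding box by (rule measure_translation[symmetric])
      finally show "measure lebesgue ((*v) ?A ` cbox a b) = measure lebesgue (cbox a b)" .
    qed
  qed
  then show ?thesis using assms unfolding P_def by blast
qed

section \<open>Parallelepiped tiles and their disjointness\<close>

text \<open>For a basis \<open>B\<close> this is an open parallelepiped, translated by the remaining
  generators with coefficients frozen at \<open>s\<close>. The strict inequalities on
  \<open>B\<close> are what later separates the tiles of different bases.\<close>

definition tile :: "('i \<Rightarrow> real ^ 'd) \<Rightarrow> 'i set \<Rightarrow> 'i set \<Rightarrow> ('i \<Rightarrow> real) \<Rightarrow> (real ^ 'd) set" where
  "tile m I B s =
    {\<Sum>i\<in>I. l i *\<^sub>R m i | l. (\<forall>i\<in>B. 0 < l i \<and> l i < 1) \<and> (\<forall>i\<in>I - B. l i = s i)}"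

lemma measure_tile:
  fixes m :: "'i \<Rightarrow> real ^ 'd"
  assumes "finite I" "B \<subseteq> I" and B: "basis_set m B"
  shows "tile m I B s \<in> lmeasurable" "measure lebesgue (tile m I B s) = abs_det m B"
proof -
  obtain g where g: "bij_betw g (UNIV :: 'd set) B" "abs_det m B = \<bar>det (sel_matrix m g)\<bar>"
    by (rule basis_set_bij[OF B])
  have inj: "inj g" using g(1) by (rule bij_betw_imp_inj_on)
  define t where "t = (\<Sum>i\<in>I - B. s i *\<^sub>R m i)"
  define Q where "Q = box (0 :: real ^ 'd) 1"
  have split: "(\<Sum>i\<in>I. f i) = (\<Sum>i\<in>I - B. f i) + (\<Sum>i\<in>B. f i)" for f :: "'i \<Rightarrow> real ^ 'd"
    using sum.subset_diff[OF assms(2,1)] .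
  have eq: "tile m I B s = (+) t ` ((*v) (sel_matrix m g) ` Q)"
  proof (intro equalityI subsetI)
    fix x assume "x \<in> tile m I B s"
    then obtain l where l: "x = (\<Sum>i\<in>I. l i *\<^sub>R m i)" "\<forall>i\<in>B. 0 < l i \<and> l i < 1"
      "\<forall>i\<in>I - B. l i = s i"
      unfolding tile_def by blast
    have "(\<Sum>i\<in>I - B. l i *\<^sub>R m i) = t" unfolding t_def using l(3) by (intro sum.cong) auto
    moreover have "(\<Sum>i\<in>B. l i *\<^sub>R m i) = sel_matrix m g *v (\<chi> j. l (g j))"
      using sum_bij_UNIV[OF g(1), of "\<lambda>i. l i *\<^sub>R m i"] by (simp add: sel_matrix_mult)
    moreover have "(\<chi> j. l (g j)) \<in> Q"
      unfolding Q_def using l(2) bij_betwE[OF g(1)] by (auto simp: mem_box_cart)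
    ultimately show "x \<in> (+) t ` ((*v) (sel_matrix m g) ` Q)"
      using l(1) split by auto
  next
    fix x assume "x \<in> (+) t ` ((*v) (sel_matrix m g) ` Q)"
    then obtain q where q: "q \<in> Q" "x = t + sel_matrix m g *v q" by auto
    define l where "l i = (if i \<in> B then q $ inv_into UNIV g i else s i)" for i
    have "(\<Sum>i\<in>I - B. l i *\<^sub>R m i) = t" unfolding t_def l_def by (intro sum.cong) auto
    moreover have "(\<Sum>i\<in>B. l i *\<^sub>R m i) = sel_matrix m g *v q"
      using sum_bij_UNIV[OF g(1), of "\<lambda>i. l i *\<^sub>R m i"] bij_betwE[OF g(1)] inj
      by (simp add: sel_matrix_mult l_def)
    ultimately have "x = (\<Sum>i\<in>I. l i *\<^sub>R m i)" using q(2) split by metis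
    moreover have "\<forall>i\<in>B. 0 < l i \<and> l i < 1"
      using q(1) unfolding Q_def l_def by (auto simp: mem_box_cart)
    moreover have "\<forall>i\<in>I - B. l i = s i" unfolding l_def by auto
    ultimately show "x \<in> tile m I B s" unfolding tile_def by blast
  qed
  have Q: "Q \<in> lmeasurable" unfolding Q_def by simp
  have "(\<Prod>i\<in>(Basis :: (real ^ 'd) set). (1 - 0) \<bullet> i) = 1"
    by (rule prod.neutral) (auto simp: Basis_vec_def inner_axis)
  then have Q1: "measure lebesgue Q = 1"
    unfolding Q_def by (simp add: measure_lborel_box_eq measure_completion less_eq_vec_def Basis_vec_def inner_axis)
  show "tile m I B s \<in> lmeasurable"
    unfolding eq by (intro measurable_translation conjunct1[OF measure_matrix_image] Q)
  show "measure lebesgue (tile m I B s) = abs_det m B"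
    unfolding eq measure_translation measure_matrix_image[OF Q, THEN conjunct2] g(2) Q1 by simp
qed

text \<open>Complementary slackness: \<open>r\<close> is the vector of reduced costs of the dual solution \<open>y\<close>.\<close>

lemma tile_cost:
  fixes m :: "'i \<Rightarrow> real ^ 'd"
  assumes "finite I" and r: "\<And>i. i \<in> I \<Longrightarrow> r i = c i - y \<bullet> m i" and rB: "\<And>i. i \<in> B \<Longrightarrow> r i = 0"
    and l: "\<And>i. i \<in> I - B \<Longrightarrow> l i = (if r i < 0 then 1 else 0)"
    and k: "\<And>i. i \<in> I \<Longrightarrow> k i \<in> {0..1::real}"
    and eq: "(\<Sum>i\<in>I. l i *\<^sub>R m i) = (\<Sum>i\<in>I. k i *\<^sub>R m i)"
  shows "(\<Sum>i\<in>I. l i * c i) \<le> (\<Sum>i\<in>I. k i * c i)"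
    and "(\<Sum>i\<in>I. l i * c i) = (\<Sum>i\<in>I. k i * c i) \<Longrightarrow> i \<in> I \<Longrightarrow> r i \<noteq> 0 \<Longrightarrow> k i = l i"
proof -
  \<comment> \<open>Both families represent the same point, so replacing \<open>c\<close> by the
    reduced costs \<open>r\<close> changes both costs by the same amount.\<close>
  have "y \<bullet> (\<Sum>i\<in>I. l i *\<^sub>R m i) = y \<bullet> (\<Sum>i\<in>I. k i *\<^sub>R m i)" using eq by simp
  then have "(\<Sum>i\<in>I. l i * (y \<bullet> m i)) = (\<Sum>i\<in>I. k i * (y \<bullet> m i))" by (simp add: inner_sum_right)
  moreover have "(\<Sum>i\<in>I. (k i - l i) * r i) = (\<Sum>i\<in>I. k i * c i) - (\<Sum>i\<in>I. l i * c i)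
      - ((\<Sum>i\<in>I. k i * (y \<bullet> m i)) - (\<Sum>i\<in>I. l i * (y \<bullet> m i)))"
    unfolding sum_subtractf[symmetric] by (rule sum.cong) (auto simp: r algebra_simps)
  ultimately have *: "(\<Sum>i\<in>I. (k i - l i) * r i) = (\<Sum>i\<in>I. k i * c i) - (\<Sum>i\<in>I. l i * c i)"
    by simp
  \<comment> \<open>Off \<open>B\<close>, \<open>l i\<close> sits at the bound favoured by the sign
    of \<open>r i\<close>, so no \<open>k i\<close> in the unit interval does better.\<close>
  have nonneg: "0 \<le> (k i - l i) * r i" if "i \<in> I" for i
  proof (cases "i \<in> B")
    case False
    then show ?thesis using l[of i] k[of i] that by (auto simp: mult_nonpos_nonpos)
  qed (simp add: rB)
  then have "0 \<le> (\<Sum>i\<in>I. (k i - l i) * r i)" by (rule sum_nonneg)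
  then show "(\<Sum>i\<in>I. l i * c i) \<le> (\<Sum>i\<in>I. k i * c i)" using * by simp
  assume "(\<Sum>i\<in>I. l i * c i) = (\<Sum>i\<in>I. k i * c i)" and i: "i \<in> I" "r i \<noteq> 0"
  then have "(\<Sum>i\<in>I. (k i - l i) * r i) = 0" using * by simp
  then have "(k i - l i) * r i = 0" using nonneg assms(1) i by (subst (asm) sum_nonneg_eq_0_iff) auto
  then show "k i = l i" using i by simp
qed

text \<open>At a common point both representations are optimal, hence of equal cost. As the reduced
  costs vanish only on the basis, the coefficients agree off \<open>B\<close>, where they are
  \<open>0\<close> or \<open>1\<close>. So \<open>B'\<close>, whose coefficients lie strictly
  between, is contained in \<open>B\<close>, and equal cardinality gives
  \<open>B = B'\<close>.\<close>

lemma disjoint_tiles: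
  fixes m :: "'i \<Rightarrow> real ^ 'd"
  assumes "finite I" "B \<subseteq> I" "B' \<subseteq> I" "card B = card B'" "B \<noteq> B'"
    and r: "\<And>i. i \<in> I \<Longrightarrow> r i = c i - y \<bullet> m i" "\<And>i. i \<in> I \<Longrightarrow> r i = 0 \<longleftrightarrow> i \<in> B"
    and r': "\<And>i. i \<in> I \<Longrightarrow> r' i = c i - y' \<bullet> m i" "\<And>i. i \<in> I \<Longrightarrow> r' i = 0 \<longleftrightarrow> i \<in> B'"
  shows "tile m I B (\<lambda>i. if r i < 0 then 1 else 0) \<inter> tile m I B' (\<lambda>i. if r' i < 0 then 1 else 0) = {}"
proof (rule ccontr)
  assume "\<not> ?thesis"
  then obtain l l' where l: "\<forall>i\<in>B. 0 < l i \<and> l i < 1" "\<forall>i\<in>I - B. l i = (if r i < 0 then 1 else 0)"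
    and l': "\<forall>i\<in>B'. 0 < l' i \<and> l' i < 1" "\<forall>i\<in>I - B'. l' i = (if r' i < 0 then 1 else 0)"
    and eq: "(\<Sum>i\<in>I. l i *\<^sub>R m i) = (\<Sum>i\<in>I. l' i *\<^sub>R m i)"
    unfolding tile_def by auto
  have l01: "l i \<in> {0..1}" "l' i \<in> {0..1}" if "i \<in> I" for i
    using l l' that by (cases "i \<in> B"; cases "i \<in> B'"; force)+
  have B0: "r i = 0" if "i \<in> B" for i using r(2) that assms(2) by blast
  have B0': "r' i = 0" if "i \<in> B'" for i using r'(2) that assms(3) by blast
  have "(\<Sum>i\<in>I. l i * c i) \<le> (\<Sum>i\<in>I. l' i * c i)"
    by (rule tile_cost(1)[OF assms(1) r(1) B0]) (use l l01 eq in auto)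
  moreover have "(\<Sum>i\<in>I. l' i * c i) \<le> (\<Sum>i\<in>I. l i * c i)"
    by (rule tile_cost(1)[OF assms(1) r'(1) B0']) (use l' l01 eq in auto)
  ultimately have e: "(\<Sum>i\<in>I. l i * c i) = (\<Sum>i\<in>I. l' i * c i)" by simp
  have "l' i = l i" if "i \<in> I - B" for i
    by (rule tile_cost(2)[OF assms(1) r(1) B0 _ _ eq e]) (use l l01 that r(2) in auto)
  then have "B' \<subseteq> B" using l(2) l'(1) assms(3) by (force split: if_splits)
  then show False using assms by (metis card_subset_eq finite_subset)
qed

text \<open>A coefficient at a bound is moved inwards by \<open>v\<close> or left alone, so a small
  step stays in the cube. Admissible steps may be shortened, and finitely many have a positive
  minimum.\<close>

lemma shift_coefficients:
  fixes l v :: "'i \<Rightarrow> real"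
  assumes "finite I" and l: "\<And>i. i \<in> I \<Longrightarrow> l i \<in> {0..1}"
    and v: "\<And>i. i \<in> I \<Longrightarrow> v i \<noteq> 0 \<Longrightarrow> 0 < l i \<and> l i < 1 \<or> l i = 0 \<and> 0 < v i \<or> l i = 1 \<and> v i < 0"
  shows "\<exists>e>0. \<forall>i\<in>I. l i + e * v i \<in> {0..1}"
  using assms
proof (induction I rule: finite_induct)
  case empty
  then show ?case by (auto intro: exI[of _ 1])
next
  case (insert j I)
  then obtain e where e: "e > 0" "\<And>i. i \<in> I \<Longrightarrow> l i + e * v i \<in> {0..1}" by auto
  obtain f where f: "f > 0" "l j + f * v j \<in> {0..1}"
  proof (cases "v j = 0")
    case True
    then show ?thesis using that[of 1] insert.prems by simp
  next
    case False
    then have *: "0 < l j \<and> l j < 1 \<or> l j = 0 \<and> 0 < v j \<or> l j = 1 \<and> v j < 0"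
      using insert.prems by blast
    \<comment> \<open>This step moves \<open>l j\<close> from one bound to the other, or from the
      interior by the distance to the nearer bound.\<close>
    define f where "f = (if l j = 0 \<or> l j = 1 then 1 else min (l j) (1 - l j)) / \<bar>v j\<bar>"
    have fv: "f * v j = (if l j = 0 \<or> l j = 1 then 1 else min (l j) (1 - l j)) * sgn (v j)"
      unfolding f_def using False by (simp add: sgn_real_def)
    show ?thesis
    proof (rule that[of f])
      show "f > 0" using * False unfolding f_def by auto
      show "l j + f * v j \<in> {0..1}" using * unfolding fv by (auto simp: sgn_real_def)
    qed
  qed
  have convex: "a + t * b \<in> {0..1}" if "a \<in> {0..1}" "a + u * b \<in> {0..1}" "0 < t" "t \<le> u" for a b t u :: real
  proof (cases "b \<ge> 0")
    case True
    then have "0 \<le> t * b" "t * b \<le> u * b" using that(3,4) by (auto intro: mult_right_mono)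
    then show ?thesis using that(1,2) by simp
  next
    case False
    then have "t * b \<le> 0" "u * b \<le> t * b"
      using that(3,4) by (simp_all add: mult_le_0_iff)
    then show ?thesis using that(1,2) by simp
  qed
  have "l i + min e f * v i \<in> {0..1}" if "i \<in> insert j I" for i
  proof (cases "i = j")
    case True
    then show ?thesis using f e(1) insert.prems(1)[of i] that by - (rule convex[where u=f], simp_all)
  next
    case False
    then have "i \<in> I" using that by simp
    then show ?thesis using f(1) e insert.prems(1)[of i] that by - (rule convex[where u=e], simp_all)
  qed
  then show ?case using e(1) f(1) by (intro exI[of _ "min e f"]) simp
qed

subsection \<open>The volume of a zonotope\<close>

lemma negligible_translated_span:
  fixes m :: "'i \<Rightarrow> real ^ 'd"
  assumes "finite F" "card F < CARD('d)"
  shows "negligible ((+) t ` span (m ` F))"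
proof -
  have "dim (m ` F) \<le> card (m ` F)" using assms(1) by (intro dim_le_card') simp
  also have "\<dots> < CARD('d)" using card_image_le[OF assms(1), of m] assms(2) by simp
  finally show ?thesis
    by (intro negligible_translation negligible_lowdim) (simp add: dim_span)
qed

theorem measure_zonotope_on:
  fixes m :: "'i \<Rightarrow> real ^ 'd"
  assumes fin: "finite I"
  shows "measure lebesgue (zonotope_on m I) = (\<Sum>B | B \<subseteq> I \<and> card B = CARD('d). abs_det m B)"
proof -
  define \<B> where "\<B> = {B. B \<subseteq> I \<and> basis_set m B}"
  have finB: "finite \<B>" unfolding \<B>_def using fin by auto
  have BI: "B \<subseteq> I" "basis_set m B" "finite B" "card B = CARD('d)" if "B \<in> \<B>" for B
    using that unfolding \<B>_def basis_set_def by auto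
  have "\<exists>a. m j = (\<Sum>b\<in>B. a b *\<^sub>R m b)" if "B \<in> \<B>" for B j
    using basis_set_expand[OF BI(2)[OF that]] by metis
  then obtain a where a: "\<And>B j. B \<in> \<B> \<Longrightarrow> m j = (\<Sum>b\<in>B. a B j b *\<^sub>R m b)" by metis
  \<comment> \<open>The fundamental circuit of \<open>j\<close> with respect to \<open>B\<close>:
    the relation expressing \<open>m j\<close> in the basis. Its cost turns out to be the reduced
    cost of \<open>j\<close>.\<close>
  define circ where "circ B j = (\<lambda>i. (if i = j then 1 else 0) - (if i \<in> B then a B j i else 0))" for B j
  \<comment> \<open>One relation is fixed for each dependent \<open>F\<close>, so that only finitely
    many relations must be avoided when the cost \<open>c\<close> is chosen.\<close>
  define dep where "dep F = (SOME v. (\<Sum>i\<in>F. v i *\<^sub>R m i) = 0 \<and> (\<exists>i\<in>F. v i \<noteq> 0))" for F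
  have dep: "(\<Sum>i\<in>F. dep F i *\<^sub>R m i) = 0 \<and> (\<exists>i\<in>F. dep F i \<noteq> 0)"
    if "(\<Sum>i\<in>F. v i *\<^sub>R m i) = 0 \<and> (\<exists>i\<in>F. v i \<noteq> 0)" for F v
    unfolding dep_def by (rule someI[of _ v]) (rule that)
  define dep' where "dep' F = (\<lambda>i. if i \<in> F then dep F i else 0)" for F
  \<comment> \<open>The circuits make the reduced costs nonzero off the basis; the relations
    \<open>dep' F\<close> make the generators with fractional coefficients at an optimum
    independent.\<close>
  define W where "W = (\<lambda>(B, j). circ B j) ` (\<B> \<times> I) \<union> dep' ` Pow I"
  have "finite W" unfolding W_def using fin finB by auto
  then obtain c :: "'i \<Rightarrow> real"
    where c: "\<And>v. v \<in> W \<Longrightarrow> \<exists>i\<in>I. v i \<noteq> 0 \<Longrightarrow> (\<Sum>i\<in>I. v i * c i) \<noteq> 0"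
    using generic_cost[OF fin] by blast
  have "\<exists>y. \<forall>b\<in>B. y \<bullet> m b = c b" if "B \<in> \<B>" for B
    using basis_set_dual[OF BI(2)[OF that]] .
  then obtain y where y: "\<And>B b. B \<in> \<B> \<Longrightarrow> b \<in> B \<Longrightarrow> y B \<bullet> m b = c b" by metis
  define r where "r B i = c i - y B \<bullet> m i" for B i
  have circ_sum: "(\<Sum>i\<in>I. circ B j i *\<^sub>R f i) = f j - (\<Sum>b\<in>B. a B j b *\<^sub>R f b)"
    if "B \<in> \<B>" "j \<in> I" for B j and f :: "'i \<Rightarrow> 'w::real_vector"
  proof -
    have "(\<Sum>i\<in>I. (if i \<in> B then a B j i else 0) *\<^sub>R f i) = (\<Sum>b\<in>B. a B j b *\<^sub>R f b)"
      using BI(1)[OF that(1)] fin by (intro sum.mono_neutral_cong_right) auto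
    moreover have "(\<Sum>i\<in>I. (if i = j then 1 else 0) *\<^sub>R f i) = f j"
      using fin that(2) by (simp add: if_distrib[of "\<lambda>c. c *\<^sub>R _"] sum.delta cong: if_cong)
    ultimately show ?thesis unfolding circ_def by (simp add: scaleR_diff_left sum_subtractf)
  qed
  have circ_m: "(\<Sum>i\<in>I. circ B j i *\<^sub>R m i) = 0" if "B \<in> \<B>" "j \<in> I" for B j
    using circ_sum[OF that, of m] a[OF that(1), of j] by simp
  have circ_c: "(\<Sum>i\<in>I. circ B j i * c i) = r B j" if B: "B \<in> \<B>" and j: "j \<in> I" for B j
  proof -
    have "y B \<bullet> m j = y B \<bullet> (\<Sum>b\<in>B. a B j b *\<^sub>R m b)" using a[OF B, of j] by simp
    also have "\<dots> = (\<Sum>b\<in>B. a B j b * c b)"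
      by (simp add: inner_sum_right y[OF B])
    finally show ?thesis using circ_sum[OF B j, of c] by (simp add: r_def)
  qed
  \<comment> \<open>For \<open>i\<close> outside \<open>B\<close>, the circuit has coefficient
    \<open>1\<close> at \<open>i\<close>, so its cost is nonzero by the choice of
    \<open>c\<close>.\<close>
  have r0: "r B i = 0 \<longleftrightarrow> i \<in> B" if B: "B \<in> \<B>" and i: "i \<in> I" for B i
  proof
    assume "r B i = 0"
    then have "(\<Sum>k\<in>I. circ B i k * c k) = 0" using circ_c[OF B i] by simp
    moreover have "circ B i \<in> W" unfolding W_def using B i by auto
    ultimately have "circ B i i = 0" using c i by blast
    then show "i \<in> B" unfolding circ_def by (auto split: if_splits)
  qed (simp add: r_def y[OF B])
  define T where "T B = tile m I B (\<lambda>i. if r B i < 0 then 1 else 0)" for B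
  \<comment> \<open>Contains the points with fewer than \<open>CARD('d)\<close> fractional
    coefficients at an optimum; \<open>S\<close> stands for the generators with coefficient
    \<open>1\<close>.\<close>
  define N where "N = (\<Union>F\<in>{F. F \<subseteq> I \<and> card F < CARD('d)}. \<Union>S\<in>Pow I. (+) (\<Sum>i\<in>S. m i) ` span (m ` F))"
  have negN: "negligible N"
    unfolding N_def using fin
    by (intro negligible_Union finite_imageI finite_UN_I)
       (auto intro!: negligible_Union negligible_translated_span intro: finite_subset)
  have T_sub: "T B \<subseteq> zonotope_on m I" if B: "B \<in> \<B>" for B
  proof
    fix x assume "x \<in> T B"
    then obtain l where l: "x = (\<Sum>i\<in>I. l i *\<^sub>R m i)" "\<forall>i\<in>B. 0 < l i \<and> l i < 1"
      "\<forall>i\<in>I - B. l i = (if r B i < 0 then 1 else 0)"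
      unfolding T_def tile_def by blast
    have "\<forall>i\<in>I. l i \<in> {0..1}"
    proof
      fix i assume "i \<in> I"
      then show "l i \<in> {0..1}" using l(2,3) by (cases "i \<in> B") force+
    qed
    then show "x \<in> zonotope_on m I" unfolding zonotope_on_def using l(1) by blast
  qed
  have cover: "x \<in> \<Union>(T ` \<B>) \<union> N" if x: "x \<in> zonotope_on m I" for x
  proof -
    obtain l where l: "\<forall>i\<in>I. l i \<in> {0..1::real}" "x = (\<Sum>i\<in>I. l i *\<^sub>R m i)"
      and opt: "\<And>k. \<forall>i\<in>I. k i \<in> {0..1} \<Longrightarrow> x = (\<Sum>i\<in>I. k i *\<^sub>R m i) \<Longrightarrow>
       (\<Sum>i\<in>I. l i * c i) \<le> (\<Sum>i\<in>I. k i * c i)"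
      by (rule optimal_coefficients[OF fin x, of c]) blast
    \<comment> \<open>If the optimal coefficients can move a little along the relation
      \<open>v\<close> without leaving the cube, this gives another representation of
      \<open>x\<close>, so \<open>v\<close> cannot have negative cost.\<close>
    have no_descent: "0 \<le> (\<Sum>i\<in>I. v i * c i)" if v: "(\<Sum>i\<in>I. v i *\<^sub>R m i) = 0"
      "\<And>i. i \<in> I \<Longrightarrow> v i \<noteq> 0 \<Longrightarrow> 0 < l i \<and> l i < 1 \<or> l i = 0 \<and> 0 < v i \<or> l i = 1 \<and> v i < 0" for v
    proof -
      obtain e where e: "e > 0" "\<forall>i\<in>I. l i + e * v i \<in> {0..1}"
        using shift_coefficients[OF fin, of l v] l(1) v(2) by metis
      have "(\<Sum>i\<in>I. (l i + e * v i) *\<^sub>R m i) = x + e *\<^sub>R (\<Sum>i\<in>I. v i *\<^sub>R m i)"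
        unfolding l(2) by (simp add: scaleR_add_left sum.distrib scaleR_sum_right)
      then have "(\<Sum>i\<in>I. l i * c i) \<le> (\<Sum>i\<in>I. (l i + e * v i) * c i)"
        using opt[OF e(2)] v(1) by simp
      also have "\<dots> = (\<Sum>i\<in>I. l i * c i) + e * (\<Sum>i\<in>I. v i * c i)"
        by (simp add: algebra_simps sum.distrib sum_distrib_left)
      finally show ?thesis using e(1) by (simp add: zero_le_mult_iff)
    qed
    define F where "F = {i\<in>I. 0 < l i \<and> l i < 1}"
    have F: "F \<subseteq> I" "finite F" unfolding F_def using fin by auto
    \<comment> \<open>Fractional coefficients can move both ways along a relation supported on
      \<open>F\<close>, which would force its cost to be zero.\<close>
    have ind: "\<forall>i\<in>F. v i = 0" if "(\<Sum>i\<in>F. v i *\<^sub>R m i) = 0" for v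
    proof (rule ccontr)
      assume "\<not> (\<forall>i\<in>F. v i = 0)"
      then have d: "(\<Sum>i\<in>F. dep F i *\<^sub>R m i) = 0" "\<exists>i\<in>F. dep F i \<noteq> 0"
        using dep[of v F] that by blast+
      have "(\<Sum>i\<in>I. dep' F i *\<^sub>R m i) = (\<Sum>i\<in>F. dep F i *\<^sub>R m i)"
        unfolding dep'_def using F fin by (intro sum.mono_neutral_cong_right) auto
      then have d0: "(\<Sum>i\<in>I. dep' F i *\<^sub>R m i) = 0" using d by simp
      have "(\<Sum>i\<in>I. dep' F i * c i) \<noteq> 0"
      proof (rule c)
        show "dep' F \<in> W" unfolding W_def using F by blast
        show "\<exists>i\<in>I. dep' F i \<noteq> 0" unfolding dep'_def using d F by auto
      qed
      moreover have "0 \<le> (\<Sum>i\<in>I. dep' F i * c i)"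
        by (rule no_descent[OF d0]) (auto simp: dep'_def F_def split: if_splits)
      moreover have "0 \<le> (\<Sum>i\<in>I. (- dep' F i) * c i)"
        by (rule no_descent) (use d0 in \<open>auto simp: sum_negf dep'_def F_def split: if_splits\<close>)
      ultimately show False by (simp add: sum_negf)
    qed
    have le: "card F \<le> CARD('d)" using independent_card_le[OF F(2) ind] .
    show ?thesis
    proof (cases "card F = CARD('d)")
      case True
      then have FB: "F \<in> \<B>" unfolding \<B>_def using independent_is_basis_set[OF F(2) _ ind] F(1) by blast
      \<comment> \<open>The circuit of \<open>j\<close> changes \<open>l j\<close> and otherwise
        only fractional coefficients. Moving along it from the bound \<open>0\<close>, or backwards
        from the bound \<open>1\<close>, determines the sign of the reduced cost.\<close>
      have "l j = (if r F j < 0 then 1 else 0)" if j: "j \<in> I - F" for j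
      proof -
        have lj: "l j = 0 \<or> l j = 1" using j l(1) unfolding F_def by force
        have jI: "j \<in> I" and jF: "j \<notin> F" using j by auto
        have F1: "0 < l i \<and> l i < 1" if "circ F j i \<noteq> 0" "i \<noteq> j" for i
          using that unfolding circ_def F_def by (auto split: if_splits)
        have cjj: "circ F j j = 1" unfolding circ_def using jF by simp
        have "r F j \<noteq> 0" using r0[OF FB jI] jF by simp
        moreover have "0 \<le> r F j" if "l j = 0"
          unfolding circ_c[OF FB jI, symmetric]
          by (rule no_descent[OF circ_m[OF FB jI]]) (use F1 cjj that in \<open>metis zero_less_one\<close>)
        moreover have "0 \<le> - r F j" if "l j = 1"
        proof -
          have "0 \<le> (\<Sum>i\<in>I. (- circ F j i) * c i)"
          proof (rule no_descent)
            show "(\<Sum>i\<in>I. (- circ F j i) *\<^sub>R m i) = 0" using circ_m[OF FB jI] by (simp add: sum_negf)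
            show "0 < l i \<and> l i < 1 \<or> l i = 0 \<and> 0 < - circ F j i \<or> l i = 1 \<and> - circ F j i < 0"
              if "- circ F j i \<noteq> 0" for i
              using F1[of i] cjj that \<open>l j = 1\<close> by (cases "i = j") auto
          qed
          then show ?thesis using circ_c[OF FB jI] by (simp add: sum_negf)
        qed
        ultimately show ?thesis using lj by auto
      qed
      then have "x \<in> T F" unfolding T_def tile_def using l(2) F_def by blast
      then show ?thesis using FB by blast
    next
      case False
      define S where "S = {i\<in>I. l i = 1}"
      have "x = (\<Sum>i\<in>I - F. l i *\<^sub>R m i) + (\<Sum>i\<in>F. l i *\<^sub>R m i)"
        unfolding l(2) using sum.subset_diff[OF F(1) fin] .
      also have "(\<Sum>i\<in>I - F. l i *\<^sub>R m i) = (\<Sum>i\<in>S. m i)"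
      proof (rule sum.mono_neutral_cong_right)
        show "\<forall>i\<in>I - F - S. l i *\<^sub>R m i = 0"
          using l(1) unfolding F_def S_def by force
      qed (use fin in \<open>auto simp: F_def S_def\<close>)
      finally have "x = (\<Sum>i\<in>S. m i) + (\<Sum>i\<in>F. l i *\<^sub>R m i)" .
      moreover have "(\<Sum>i\<in>F. l i *\<^sub>R m i) \<in> span (m ` F)"
        by (intro span_sum span_scale span_base imageI)
      ultimately have "x \<in> (+) (\<Sum>i\<in>S. m i) ` span (m ` F)" by (rule image_eqI)
      moreover have "S \<in> Pow I" "F \<in> {F. F \<subseteq> I \<and> card F < CARD('d)}"
        using False le F(1) unfolding S_def by auto
      ultimately show ?thesis unfolding N_def by blast
    qed
  qed
  have T_meas: "T B \<in> lmeasurable" "measure lebesgue (T B) = abs_det m B" if "B \<in> \<B>" for B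
    unfolding T_def using measure_tile[OF fin BI(1,2)[OF that]] by auto
  have "T B \<inter> T B' = {}" if "B \<in> \<B>" "B' \<in> \<B>" "B \<noteq> B'" for B B'
    unfolding T_def
    by (rule disjoint_tiles[OF fin, where c=c and y="y B" and y'="y B'"])
       (use that BI r0 in \<open>auto simp: r_def\<close>)
  then have "pairwise (\<lambda>B B'. negligible (T B \<inter> T B')) \<B>"
    unfolding pairwise_def by simp
  then have "measure lebesgue (\<Union>(T ` \<B>)) = (\<Sum>B\<in>\<B>. measure lebesgue (T B))"
    by (intro measure_negligible_finite_Union_image finB T_meas)
  also have "\<dots> = (\<Sum>B\<in>\<B>. abs_det m B)" using T_meas by simp
  also have "\<dots> = (\<Sum>B | B \<subseteq> I \<and> card B = CARD('d). abs_det m B)"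
    by (rule sum.mono_neutral_left) (use fin in \<open>auto simp: \<B>_def basis_set_def intro: finite_subset\<close>)
  finally have "measure lebesgue (\<Union>(T ` \<B>)) = \<dots>" .
  moreover have "measure lebesgue (zonotope_on m I) = measure lebesgue (\<Union>(T ` \<B>))"
  proof (rule measure_negligible_symdiff)
    show "\<Union>(T ` \<B>) \<in> lmeasurable" by (intro fmeasurable.finite_UN finB T_meas)
    show "negligible (\<Union>(T ` \<B>) - zonotope_on m I \<union> (zonotope_on m I - \<Union>(T ` \<B>)))"
      by (rule negligible_subset[OF negN]) (use cover T_sub in blast)
  qed
  ultimately show ?thesis by simp
qed

subsection \<open>Unit vectors and minors\<close>

text \<open>A distinct index list identifies positions with indices, so coefficients can be
  transported; equal columns at different indices are still counted separately.\<close>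

lemma zonotope_map:
  fixes m :: "'i \<Rightarrow> real ^ 'd"
  assumes "distinct xs"
  shows "zonotope (map m xs) = zonotope_on m (set xs)"
proof -
  have bij: "bij_betw ((!) xs) {..<length xs} (set xs)" using bij_betw_nth[OF assms] by blast
  have sum: "(\<Sum>i<length xs. c (xs ! i) *\<^sub>R m (xs ! i)) = (\<Sum>x\<in>set xs. c x *\<^sub>R m x)" for c :: "'i \<Rightarrow> real"
    using sum.reindex_bij_betw[OF bij, of "\<lambda>x. c x *\<^sub>R m x"] .
  show ?thesis
  proof (intro equalityI subsetI)
    fix v assume "v \<in> zonotope (map m xs)"
    then obtain c where c: "v = (\<Sum>i<length xs. c i *\<^sub>R m (xs ! i))" "\<forall>i<length xs. c i \<in> {0..1::real}"
      unfolding zonotope_def by auto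
    define k where "k x = c (inv_into {..<length xs} ((!) xs) x)" for x
    have k: "k (xs ! i) = c i" if "i < length xs" for i
      unfolding k_def using bij_betw_inv_into_left[OF bij] that by simp
    have "v = (\<Sum>x\<in>set xs. k x *\<^sub>R m x)" unfolding c(1) sum[symmetric] using k by simp
    moreover have "\<forall>x\<in>set xs. k x \<in> {0..1}" using k c(2) by (metis in_set_conv_nth)
    ultimately show "v \<in> zonotope_on m (set xs)" unfolding zonotope_on_def by blast
  next
    fix v assume "v \<in> zonotope_on m (set xs)"
    then obtain k where k: "v = (\<Sum>x\<in>set xs. k x *\<^sub>R m x)" "\<forall>x\<in>set xs. k x \<in> {0..1::real}"
      unfolding zonotope_on_def by blast
    then have "v = (\<Sum>i<length (map m xs). k (xs ! i) *\<^sub>R (map m xs) ! i)"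
      using sum[of k] by simp
    moreover have "\<forall>i<length (map m xs). k (xs ! i) \<in> {0..1}" using k(2) by simp
    ultimately show "v \<in> zonotope (map m xs)" unfolding zonotope_def
      by (intro CollectI exI[of _ "\<lambda>i. k (xs ! i)"] conjI)
  qed
qed

text \<open>An injection into the positions names a set of \<open>CARD('d)\<close> indices. The sign
  lost in \<open>abs_det\<close> is harmless, as the set of allowed values is symmetric.\<close>

lemma two_modular_map:
  fixes m :: "'i \<Rightarrow> real ^ 'd"
  assumes "distinct xs"
    and det: "\<And>B. B \<subseteq> set xs \<Longrightarrow> card B = CARD('d) \<Longrightarrow> abs_det m B \<in> {0, 1, 2}"
  shows "two_modular (map m xs)"
  unfolding two_modular_def
proof (intro allI impI)
  fix f :: "'d \<Rightarrow> nat"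
  assume f: "inj f \<and> range f \<subseteq> {..<length (map m xs)}"
  then have lt: "f j < length xs" for j by (auto simp: image_subset_iff)
  define g where "g = (!) xs \<circ> f"
  have "inj g"
    unfolding g_def using f assms(1) by (intro comp_inj_on inj_on_nth) (auto simp: lt)
  then have g: "bij_betw g UNIV (range g)" by (rule inj_on_imp_bij_betw)
  have "range g \<subseteq> set xs" using lt unfolding g_def by auto
  moreover have "card (range g) = CARD('d)" using \<open>inj g\<close> by (rule card_image)
  ultimately have "\<bar>det (sel_matrix m g)\<bar> \<in> {0, 1, 2}" using det abs_det_eq[OF g, of m] by metis
  moreover have "square_submatrix (map m xs) f = sel_matrix m g"
    by (simp add: square_submatrix_def sel_matrix_def g_def lt)
  ultimately show "det (square_submatrix (map m xs) f) \<in> {- 2, - 1, 0, 1, 2}" by auto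
qed

text \<open>The determinant of the rows \<open>ts\<close> and columns \<open>us\<close> of \<open>A\<close>, expanded along the column \<open>u\<close>:
  putting \<open>t\<close> in the place of the deleted row makes all the signs after the first one negative.\<close>

fun minor :: "('a \<Rightarrow> 'b \<Rightarrow> int) \<Rightarrow> 'a list \<Rightarrow> 'b list \<Rightarrow> int" where
  "minor A (t # ts) (u # us) = A t u * minor A ts us
     - (\<Sum>l\<leftarrow>[0..<length ts]. A (ts ! l) u * minor A (ts[l := t]) us)"
| "minor A _ _ = 1"

text \<open>Renaming rows carries minors from an abstract index type to numbered rows, where they
  can be evaluated.\<close>

lemma minor_map:
  assumes "length ts = length us" "\<And>p. p \<in> set ts \<Longrightarrow> A (r p) = B p"
  shows "minor A (map r ts) us = minor B ts us"
  using assms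
proof (induction us arbitrary: ts)
  case (Cons u us)
  then obtain t ts' where ts: "ts = t # ts'" by (cases ts) auto
  have "minor A ((map r ts')[l := r t]) us = minor B (ts'[l := t]) us" for l
  proof -
    have "minor A (map r (ts'[l := t])) us = minor B (ts'[l := t]) us"
      by (rule Cons.IH) (use Cons.prems ts set_update_subset_insert[of ts' l t] in auto)
    then show ?thesis by (simp add: map_update)
  qed
  then show ?case
    using Cons.IH[of ts'] Cons.prems ts by (auto intro!: arg_cong[of _ _ sum_list])
qed simp

text \<open>For distinct \<open>ts\<close> as long as \<open>us\<close>, the unit vector at position
  \<open>ts ! l\<close> is exchanged for the column \<open>us ! l\<close>; the other positions keep
  theirs.\<close>

fun exchange :: "'a list \<Rightarrow> 'b list \<Rightarrow> 'a \<Rightarrow> 'a + 'b" where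
  "exchange (t # ts) (u # us) = (exchange ts us)(t := Inr u)"
| "exchange _ _ = Inl"

lemma exchange_outside: "j \<notin> set ts \<Longrightarrow> exchange ts us j = Inl j"
  by (induction ts us rule: exchange.induct) auto

lemma exchange_nth:
  "distinct ts \<Longrightarrow> length ts = length us \<Longrightarrow> l < length ts \<Longrightarrow> exchange ts us (ts ! l) = Inr (us ! l)"
proof (induction ts us arbitrary: l rule: exchange.induct)
  case (1 t ts u us)
  then show ?case by (cases l) auto
qed auto

lemma exchange_bij:
  assumes "distinct ts" "distinct us" "length ts = length us"
  shows "bij_betw (exchange ts us) UNIV (Inl ` (- set ts) \<union> Inr ` set us)"
proof -
  have "bij_betw (exchange ts us) (- set ts) (Inl ` (- set ts))"
    by (rule bij_betw_cong[THEN iffD2, of _ _ Inl])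
       (auto simp: exchange_outside intro: inj_on_imp_bij_betw)
  moreover have "bij_betw (exchange ts us) (set ts) (Inr ` set us)"
  proof (rule bij_betw_imageI)
    show "inj_on (exchange ts us) (set ts)"
      using assms by (auto simp: inj_on_def in_set_conv_nth exchange_nth nth_eq_iff_index_eq)
    have "exchange ts us ` set ts = (\<lambda>l. exchange ts us (ts ! l)) ` {..<length ts}"
      by (auto simp: set_conv_nth)
    also have "\<dots> = (\<lambda>l. Inr (us ! l)) ` {..<length us}"
      using assms by (intro image_cong) (auto simp: exchange_nth)
    finally show "exchange ts us ` set ts = Inr ` set us" by (auto simp: set_conv_nth)
  qed
  ultimately show ?thesis
    using bij_betw_combine[of "exchange ts us" "- set ts" _ "set ts"] by (simp add: Compl_partition2) blast
qed

text \<open>The columns of \<open>(I|A)\<close>, with integer entries in \<open>A\<close> so that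
  its minors can be computed exactly.\<close>

definition unit_ext :: "('d \<Rightarrow> 'k \<Rightarrow> int) \<Rightarrow> 'd + 'k \<Rightarrow> real ^ 'd" where
  "unit_ext A = case_sum (\<lambda>i. axis i 1) (\<lambda>u. \<chi> i. of_int (A i u))"

text \<open>Induction on \<open>us\<close>, with the selected vectors as rows: the one at
  \<open>t\<close> is the column \<open>u\<close>, which is expanded in unit vectors. Only those at
  \<open>t\<close> and at the other exchanged positions survive, and they reproduce the recursion of
  \<open>minor\<close>.\<close>

lemma det_exchange:
  fixes A :: "'d::finite \<Rightarrow> 'k \<Rightarrow> int"
  assumes "distinct ts" "length ts = length us"
  shows "det (\<chi> j. unit_ext A (exchange ts us j)) = of_int (minor A ts us)"
  using assms
proof (induction us arbitrary: ts)
  case Nil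
  have "(\<chi> j. unit_ext A (exchange ts [] j)) = mat 1"
    by (simp add: unit_ext_def axis_def mat_def vec_eq_iff eq_commute)
  then show ?case using Nil by simp
next
  case (Cons u us)
  then obtain t ts' where ts: "ts = t # ts'" by (cases ts) auto
  have t: "t \<notin> set ts'" "distinct ts'" "length ts' = length us" using Cons.prems ts by auto
  define c where "c j = unit_ext A (exchange ts' us j)" for j
  define D where "D v = det (\<chi> j. if j = t then v else c j)" for v
  have "(\<chi> j. unit_ext A (exchange ts (u # us) j)) =
      (\<chi> j. if j = t then (\<Sum>i\<in>UNIV. of_int (A i u) *s axis i 1) else c j)"
    by (auto simp: vec_eq_iff ts c_def unit_ext_def axis_def if_distrib sum.delta cong: if_cong)
  then have "det (\<chi> j. unit_ext A (exchange ts (u # us) j)) =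
      (\<Sum>i\<in>UNIV. det (\<chi> j. if j = t then of_int (A i u) *s axis i 1 else c j))"
    by (simp add: det_linear_row_sum)
  also have "\<dots> = (\<Sum>i\<in>UNIV. of_int (A i u) * D (axis i 1))"
    unfolding D_def by (simp add: det_row_mul)
  \<comment> \<open>A unit vector of an unexchanged position other than \<open>t\<close> already
    occurs there, so the determinant has two equal rows.\<close>
  also have "\<dots> = (\<Sum>i\<in>insert t (set ts'). of_int (A i u) * D (axis i 1))"
  proof (rule sum.mono_neutral_right)
    show "\<forall>i\<in>UNIV - insert t (set ts'). of_int (A i u) * D (axis i 1) = 0"
    proof
      fix i assume i: "i \<in> UNIV - insert t (set ts')"
      then have "c i = axis i 1" by (simp add: c_def exchange_outside unit_ext_def)
      then have "D (axis i 1) = 0"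
        unfolding D_def using i
        by (intro det_identical_rows[of t i]) (auto simp: row_def vec_eq_iff)
      then show "of_int (A i u) * D (axis i 1) = 0" by simp
    qed
  qed auto
  also have "\<dots> = of_int (A t u) * D (axis t 1) + (\<Sum>i\<in>set ts'. of_int (A i u) * D (axis i 1))"
    using t by simp
  also have "(\<Sum>i\<in>set ts'. of_int (A i u) * D (axis i 1)) =
      (\<Sum>l<length ts'. of_int (A (ts' ! l) u) * D (axis (ts' ! l) 1))"
    by (rule sum.reindex_bij_betw[OF bij_betw_nth[OF t(2) refl refl], symmetric])
  also have "\<dots> = (\<Sum>l<length ts'. - of_int (A (ts' ! l) u * minor A (ts'[l := t]) us))"
  proof (rule sum.cong[OF refl])
    fix l assume "l \<in> {..<length ts'}"
    then have l: "l < length ts'" by simp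
    let ?i = "ts' ! l"
    let ?s = "Transposition.transpose t ?i"
    have it: "?i \<noteq> t" using t(1) nth_mem[OF l] by auto
    have d: "distinct (ts'[l := t])" using t(1,2) by (simp add: distinct_list_update)
    \<comment> \<open>Swapping the positions \<open>t\<close> and \<open>?i\<close> returns the unit
      vector to its own place and puts the column \<open>us ! l\<close> at \<open>t\<close>; this
      swap is the source of the negative sign.\<close>
    have "exchange (ts'[l := t]) us j = (if ?s j = t then Inl ?i else exchange ts' us (?s j))" for j
    proof -
      consider "j = t" | "j = ?i" | p where "j = ts' ! p" "p < length ts'" "p \<noteq> l" | "j \<notin> insert t (set ts')"
        by (metis in_set_conv_nth insertE)
      then show ?thesis
      proof cases
        case 1
        then show ?thesis using exchange_nth[OF d, of us l] exchange_nth[OF t(2,3) l] l t(3) it by simp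
      next
        case 2
        have "?i \<notin> set (ts'[l := t])"
          using t(2) l it by (auto simp: in_set_conv_nth nth_list_update nth_eq_iff_index_eq split: if_splits)
        then show ?thesis using 2 by (simp add: exchange_outside)
      next
        case 3
        then have jt: "j \<noteq> t" using t(1) nth_mem[OF 3(2)] by auto
        moreover have "j \<noteq> ?i" using 3 t(2) l by (simp add: nth_eq_iff_index_eq)
        ultimately have "?s j = j" by simp
        then show ?thesis
          using jt exchange_nth[OF d, of us p] exchange_nth[OF t(2,3), of p] 3 t(3) by simp
      next
        case 4
        then have "j \<noteq> ?i" "j \<noteq> t" using l by auto
        then have "?s j = j" by simp
        moreover have "j \<notin> set (ts'[l := t])" using 4 set_update_subset_insert[of ts' l t] by blast
        ultimately show ?thesis using 4 by (simp add: exchange_outside)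
      qed
    qed
    then have eq: "(\<chi> j. unit_ext A (exchange (ts'[l := t]) us j)) =
        (\<chi> j. (\<chi> j. if j = t then axis ?i 1 else c j) $ ?s j)"
      by (auto simp: vec_eq_iff c_def unit_ext_def)
    have "det (\<chi> j. unit_ext A (exchange (ts'[l := t]) us j)) = of_int (sign ?s) * D (axis ?i 1)"
      unfolding eq D_def by (rule det_permute_rows) (rule permutes_swap_id[OF UNIV_I UNIV_I])
    then have "det (\<chi> j. unit_ext A (exchange (ts'[l := t]) us j)) = - D (axis ?i 1)"
      using it by (simp add: sign_swap_id)
    then have "D (axis ?i 1) = - of_int (minor A (ts'[l := t]) us)"
      using Cons.IH[OF d] t(3) by simp
    then show "of_int (A ?i u) * D (axis ?i 1) = - of_int (A ?i u * minor A (ts'[l := t]) us)" by simp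
  qed
  also have "D (axis t 1) = of_int (minor A ts' us)"
  proof -
    have "(\<lambda>j. if j = t then axis t 1 else c j) = c"
      using t(1) by (auto simp: fun_eq_iff c_def exchange_outside unit_ext_def)
    then have "D (axis t 1) = det (\<chi> j. c j)" unfolding D_def by simp
    then show ?thesis using Cons.IH[OF t(2,3)] by (simp add: c_def)
  qed
  finally show ?case
    by (simp add: ts interv_sum_list_conv_sum_set_nat sum_negf atLeast0LessThan)
qed

lemma abs_det_exchange:
  fixes A :: "'d::finite \<Rightarrow> 'k \<Rightarrow> int"
  assumes "distinct ts" "distinct us" "length ts = length us"
  shows "abs_det (unit_ext A) (Inl ` (- set ts) \<union> Inr ` set us) = of_int \<bar>minor A ts us\<bar>"
proof -
  have "sel_matrix (unit_ext A) (exchange ts us) = transpose (\<chi> j. unit_ext A (exchange ts us j))"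
    by (simp add: sel_matrix_def transpose_def vec_eq_iff)
  then show ?thesis
    using abs_det_eq[OF exchange_bij[OF assms], of "unit_ext A"] det_exchange[OF assms(1,3), of A]
    by (simp add: det_transpose)
qed

text \<open>All selected vectors vanish in row \<open>i\<close>: the unit vector of \<open>i\<close>
  is missing and \<open>A\<close> is zero there.\<close>

lemma abs_det_zero_row:
  fixes A :: "'d::finite \<Rightarrow> 'k \<Rightarrow> int"
  assumes "finite U" "card T = card U" "i \<in> T" "\<And>u. A i u = 0"
  shows "abs_det (unit_ext A) (Inl ` (- T) \<union> Inr ` U) = 0"
proof -
  obtain ts us where l: "set ts = T" "distinct ts" "set us = U" "distinct us"
    using finite_distinct_list assms(1) finite by metis
  then have len: "length ts = length us" using assms(2) distinct_card by metis
  have "unit_ext A (exchange ts us j) $ i = 0" for j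
  proof (cases "j \<in> T")
    case True
    then obtain p where "j = ts ! p" "p < length ts" using l by (metis in_set_conv_nth)
    then show ?thesis using exchange_nth[OF l(2) len] assms(4) by (simp add: unit_ext_def)
  next
    case False
    then have "i \<noteq> j" using assms(3) by auto
    then show ?thesis using False l(1) by (simp add: exchange_outside unit_ext_def axis_def)
  qed
  then have "det (\<chi> j. unit_ext A (exchange ts us j)) = 0"
    by (intro det_zero_column[of i]) (simp add: column_def vec_eq_iff)
  then show ?thesis
    using det_exchange[OF l(2) len, of A] abs_det_exchange[OF l(2,4) len, of A] l by simp
qed

lemma card_exchange:
  fixes T :: "'d::finite set"
  assumes "finite U"
  shows "card (Inl ` (- T) \<union> Inr ` U) = CARD('d) \<longleftrightarrow> card T = card U"
proof -
  have "card (Inl ` (- T) \<union> Inr ` U) = card (- T) + card U"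
    using assms by (subst card_Un_disjoint) (auto simp: card_image)
  also have "card (- T) = CARD('d) - card T" by (simp add: Compl_eq_Diff_UNIV card_Diff_subset)
  finally show ?thesis using card_mono[of UNIV T] by auto
qed

section \<open>Sums of minors of all sizes\<close>

lemma sum_Pow_subseqs:
  assumes "distinct xs"
  shows "(\<Sum>X\<in>Pow (set xs). f X) = (\<Sum>ys\<leftarrow>subseqs xs. f (set ys))"
  using distinct_set_subseqs[OF assms]
  by (simp add: subseqs_powset[symmetric] sum.distinct_set_conv_list o_def del: subseqs_powset flip: set_map)

lemma of_int_sum_list: "of_int (\<Sum>x\<leftarrow>xs. f x) = (\<Sum>x\<leftarrow>xs. of_int (f x))"
  by (induction xs) simp_all

lemma subseqs_map: "subseqs (map f xs) = map (map f) (subseqs xs)"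
  by (induction xs) (auto simp: Let_def o_def)

text \<open>For distinct rows and columns this is the sum of the absolute minors of all sizes, in a
  form that can be evaluated. The empty minor contributes \<open>1\<close>, the volume of the unit
  cube.\<close>

definition minor_sum :: "('a \<Rightarrow> 'b \<Rightarrow> int) \<Rightarrow> 'a list \<Rightarrow> 'b list \<Rightarrow> int" where
  "minor_sum A rs ks = (\<Sum>us\<leftarrow>subseqs ks. \<Sum>ts\<leftarrow>subseqs rs.
     if length ts = length us then \<bar>minor A ts us\<bar> else 0)"

lemma minor_sum_map:
  assumes "\<And>p. p \<in> set rs \<Longrightarrow> A (r p) = B p"
  shows "minor_sum A (map r rs) ks = minor_sum B rs ks"
proof -
  have "minor A (map r ts) us = minor B ts us"
    if "ts \<in> set (subseqs rs)" "length ts = length us" for ts and us :: "'b list"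
  proof (rule minor_map[OF that(2)])
    fix p assume "p \<in> set ts"
    moreover have "set ts \<in> Pow (set rs)" using that(1) unfolding subseqs_powset[symmetric] by blast
    ultimately show "A (r p) = B p" using assms by blast
  qed
  then show ?thesis
    unfolding minor_sum_def subseqs_map map_map o_def
    by (intro arg_cong[of _ _ sum_list] map_cong refl) auto
qed

lemma Inl_Inr_vimage: "Inl ` (Inl -` B) \<union> Inr ` (Inr -` B) = B"
proof -
  have "x \<in> Inl ` (Inl -` B) \<union> Inr ` (Inr -` B)" if "x \<in> B" for x
    using that by (cases x) auto
  then show ?thesis by auto
qed

text \<open>\<open>T\<close> is the set of missing unit vectors and \<open>U\<close> the set of
  columns taken instead. Their explicit form provides the inverse map when sums over
  \<open>B\<close> are reindexed by pairs.\<close>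

lemma exchange_decomposition:
  fixes B :: "('d::finite + 'k) set"
  assumes "B \<subseteq> range Inl \<union> Inr ` K" "card B = CARD('d)" "finite K"
  obtains T U where "U \<subseteq> K" "card T = card U" "B = Inl ` (- T) \<union> Inr ` U"
    "T = - (Inl -` B)" "U = Inr -` B"
proof -
  have U: "Inr -` B \<subseteq> K" using assms(1) by auto
  have B: "B = Inl ` (- (- (Inl -` B))) \<union> Inr ` (Inr -` B)" using Inl_Inr_vimage by auto
  then have "card (- (Inl -` B)) = card (Inr -` B)"
    using card_exchange[of "Inr -` B" "- (Inl -` B)"] assms(2) finite_subset[OF U assms(3)] by simp
  then show ?thesis using that[OF U _ B refl refl] by blast
qed

text \<open>A selection missing a unit vector outside \<open>rs\<close> meets a zero row; any other
  gives a minor with rows in \<open>rs\<close>. Modularity thus reduces to these minors.\<close>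

lemma abs_det_unit_ext_cases:
  fixes A :: "'d::finite \<Rightarrow> 'k \<Rightarrow> int"
  assumes "distinct rs" "distinct ks" and zero: "\<And>i u. i \<notin> set rs \<Longrightarrow> A i u = 0"
    and B: "B \<subseteq> range Inl \<union> Inr ` set ks" "card B = CARD('d)"
  obtains "abs_det (unit_ext A) B = 0"
  | ts us where "ts \<in> set (subseqs rs)" "us \<in> set (subseqs ks)" "length ts = length us"
      "abs_det (unit_ext A) B = of_int \<bar>minor A ts us\<bar>"
proof -
  obtain T U where UT: "U \<subseteq> set ks" "card T = card U" "B = Inl ` (- T) \<union> Inr ` U"
    by (rule exchange_decomposition[OF B finite_set])
  show ?thesis
  proof (cases "T \<subseteq> set rs")
    case True
    then have "T \<in> set ` set (subseqs rs)" "U \<in> set ` set (subseqs ks)"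
      using UT(1) by (simp_all add: subseqs_powset)
    then obtain ts us where l: "ts \<in> set (subseqs rs)" "us \<in> set (subseqs ks)" "T = set ts" "U = set us"
      by blast
    then have d: "distinct ts" "distinct us" using assms(1,2) subseqs_distinctD by blast+
    then have "length ts = length us" using UT(2) l by (simp add: distinct_card)
    then show ?thesis using that(2) l abs_det_exchange[OF d] UT(3) by metis
  next
    case False
    then obtain i where "i \<in> T" "i \<notin> set rs" by blast
    then have "abs_det (unit_ext A) B = 0"
      unfolding UT(3) using UT(1,2) zero finite_subset[OF UT(1)] by (intro abs_det_zero_row) auto
    then show ?thesis by (rule that(1))
  qed
qed

text \<open>The volume formula is reindexed by the missing unit vectors and the columns replacing
  them. Zero rows can then be left out, so the dimension may exceed the number of rows in
  \<open>rs\<close>.\<close>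

lemma measure_zonotope_on_unit_ext:
  fixes A :: "'d::finite \<Rightarrow> 'k \<Rightarrow> int"
  assumes "distinct rs" "distinct ks" and zero: "\<And>i u. i \<notin> set rs \<Longrightarrow> A i u = 0"
  shows "measure lebesgue (zonotope_on (unit_ext A) (range Inl \<union> Inr ` set ks)) = of_int (minor_sum A rs ks)"
proof -
  define h where "h U T = abs_det (unit_ext A) (Inl ` (- T) \<union> Inr ` U)" for U T
  define \<P> where "\<P> = (SIGMA U:Pow (set ks). {T :: 'd set. card T = card U})"
  have "measure lebesgue (zonotope_on (unit_ext A) (range Inl \<union> Inr ` set ks)) =
      (\<Sum>B | B \<subseteq> range Inl \<union> Inr ` set ks \<and> card B = CARD('d). abs_det (unit_ext A) B)"
    by (rule measure_zonotope_on) simp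
  also have "\<dots> = (\<Sum>(U, T)\<in>\<P>. h U T)"
  proof (rule sum.reindex_bij_witness[of _ "\<lambda>(U, T). Inl ` (- T) \<union> Inr ` U" "\<lambda>B. (Inr -` B, - (Inl -` B))"])
    fix B :: "('d + 'k) set" assume B: "B \<in> {B. B \<subseteq> range Inl \<union> Inr ` set ks \<and> card B = CARD('d)}"
    then have B': "B \<subseteq> range Inl \<union> Inr ` set ks" "card B = CARD('d)" by auto
    obtain T U where UT: "U \<subseteq> set ks" "card T = card U" "B = Inl ` (- T) \<union> Inr ` U"
        "T = - (Inl -` B)" "U = Inr -` B"
      by (rule exchange_decomposition[OF B' finite_set])
    have e: "(Inr -` B, - (Inl -` B)) = (U, T)" using UT(4,5) by simp
    show "(case (Inr -` B, - (Inl -` B)) of (U, T) \<Rightarrow> Inl ` (- T) \<union> Inr ` U) = B"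
      unfolding e using UT(3) by simp
    show "(Inr -` B, - (Inl -` B)) \<in> \<P>" unfolding e \<P>_def using UT(1,2) by auto
    show "(case (Inr -` B, - (Inl -` B)) of (U, T) \<Rightarrow> h U T) = abs_det (unit_ext A) B"
      unfolding e h_def using UT(3) by simp
  next
    fix p assume p: "p \<in> \<P>"
    then obtain U T where UT: "p = (U, T)" "U \<subseteq> set ks" "card T = card U"
      unfolding \<P>_def by auto
    show "(Inr -` (case p of (U, T) \<Rightarrow> Inl ` (- T) \<union> Inr ` U), - (Inl -` (case p of (U, T) \<Rightarrow> Inl ` (- T) \<union> Inr ` U))) = p"
      using UT by auto
    have "finite U" using UT(2) by (rule finite_subset) simp
    then show "(case p of (U, T) \<Rightarrow> Inl ` (- T) \<union> Inr ` U) \<in>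
        {B. B \<subseteq> range Inl \<union> Inr ` set ks \<and> card B = CARD('d)}"
      using UT card_exchange[of U T] by auto
  qed
  also have "\<dots> = (\<Sum>U\<in>Pow (set ks). \<Sum>T | card T = card U. h U T)"
    unfolding \<P>_def by (rule sum.Sigma[symmetric]) auto
  also have "\<dots> = (\<Sum>U\<in>Pow (set ks). \<Sum>T\<in>Pow (set rs). if card T = card U then h U T else 0)"
  proof (rule sum.cong[OF refl])
    fix U assume "U \<in> Pow (set ks)"
    then have "finite U" by (auto intro: finite_subset)
    then have "h U T = 0" if "card T = card U" "T \<notin> Pow (set rs)" for T
      using that zero abs_det_zero_row[of U T] unfolding h_def by blast
    then show "(\<Sum>T | card T = card U. h U T) = (\<Sum>T\<in>Pow (set rs). if card T = card U then h U T else 0)"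
      by (intro sum.mono_neutral_cong) auto
  qed
  also have "\<dots> = (\<Sum>us\<leftarrow>subseqs ks. \<Sum>ts\<leftarrow>subseqs rs.
      if card (set ts) = card (set us) then h (set us) (set ts) else 0)"
    by (simp only: sum_Pow_subseqs assms(1,2))
  also have "\<dots> = (\<Sum>us\<leftarrow>subseqs ks. \<Sum>ts\<leftarrow>subseqs rs.
      of_int (if length ts = length us then \<bar>minor A ts us\<bar> else 0))"
  proof (intro arg_cong[of _ _ sum_list] map_cong refl)
    fix us ts assume "us \<in> set (subseqs ks)" "ts \<in> set (subseqs rs)"
    then have "distinct us" "distinct ts" using assms(1,2) subseqs_distinctD by blast+
    then show "(if card (set ts) = card (set us) then h (set us) (set ts) else 0) =
        of_int (if length ts = length us then \<bar>minor A ts us\<bar> else 0)"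
      unfolding h_def using abs_det_exchange[of ts us A] by (simp add: distinct_card)
  qed
  also have "\<dots> = of_int (minor_sum A rs ks)"
    unfolding minor_sum_def by (simp only: of_int_sum_list)
  finally show ?thesis .
qed

section \<open>The four-dimensional example and its extension by zero rows\<close>

text \<open>The inner lists are the columns \<open>a\<close>, \<open>b\<close>, \<open>w\<close>,
  \<open>w'\<close> in this order, so \<open>u\<close> selects the column and \<open>p\<close> the
  row.\<close>

definition cols :: "nat \<Rightarrow> nat \<Rightarrow> int" where
  "cols p u = [[0, 1, -1, 1], [1, 0, 1, 1], [1, 1, 0, 1], [0, 0, 1, 1]] ! u ! p"

text \<open>These are the volumes of the zonotopes of \<open>V\<close>, \<open>(V|w)\<close>,
  \<open>(V|w')\<close> and \<open>(V|w|w')\<close>.\<close>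

lemma minor_sum_cols:
  "minor_sum cols [0, 1, 2, 3] [0, 1] = 14"
  "minor_sum cols [0, 1, 2, 3] [0, 1, 2] = 30"
  "minor_sum cols [0, 1, 2, 3] [0, 1, 3] = 26"
  "minor_sum cols [0, 1, 2, 3] [0, 1, 2, 3] = 56"
  by code_simp+

text \<open>Once the unit vectors are adjoined, this bound on the minors of all sizes amounts to
  2-modularity.\<close>

lemma minor_cols:
  "\<forall>us\<in>set (subseqs [0, 1, 2, 3]). \<forall>ts\<in>set (subseqs [0, 1, 2, 3]).
    length ts = length us \<longrightarrow> \<bar>minor cols ts us\<bar> \<le> 2"
  by code_simp

theorem theorem3p1:
  assumes "CARD('d::finite) \<ge> 4"
  shows "\<exists>n\<ge>1. \<exists>(V :: 'd col_matrix) (w :: real ^ 'd) (w' :: real ^ 'd).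
    length V = n \<and>
    two_modular (V @ [w, w']) \<and>
    measure lebesgue (zonotope V) * measure lebesgue (zonotope (V @ [w, w']))
      > measure lebesgue (zonotope (V @ [w])) * measure lebesgue (zonotope (V @ [w']))"
proof -
  let ?N = "[0, 1, 2, 3] :: nat list"
  obtain es where es: "set es = (UNIV :: 'd set)" "distinct es"
    using finite_distinct_list[OF finite] by blast
  have len: "length es \<ge> 4" using assms es distinct_card by metis
  define r where "r = (!) es"
  have inj: "inj_on r (set ?N)" unfolding r_def using es(2) len by (intro inj_on_nth) auto
  define rs where "rs = map r ?N"
  \<comment> \<open>Four of the \<open>CARD('d)\<close> rows carry the example, and all others are
    zero.\<close>
  define A where "A i u = (if i \<in> set rs then cols (inv_into (set ?N) r i) u else 0)" for i u
  have drs: "distinct rs" unfolding rs_def distinct_map using inj by simp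
  have A: "A (r p) = cols p" if "p \<in> set ?N" for p
    unfolding A_def rs_def using inv_into_f_f[OF inj that] that by auto
  \<comment> \<open>The unit vectors come first, so that extending \<open>ks\<close> at its end
    appends columns to the matrix.\<close>
  define W where "W ks = map (unit_ext A) (map Inl es @ map Inr ks)" for ks
  have set: "set (map Inl es @ map Inr ks) = range Inl \<union> Inr ` set ks" for ks :: "nat list"
    using es(1) by auto
  have dist: "distinct (map Inl es @ map Inr ks)" if "distinct ks" for ks :: "nat list"
    using es(2) that by (auto simp: distinct_map)
  have zero: "A i u = 0" if "i \<notin> set rs" for i u unfolding A_def using that by simp
  have vol: "measure lebesgue (zonotope (W ks)) = of_int (minor_sum cols ?N ks)" if "distinct ks" for ks
  proof -
    have "measure lebesgue (zonotope (W ks)) = measure lebesgue (zonotope_on (unit_ext A) (range Inl \<union> Inr ` set ks))"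
      unfolding W_def zonotope_map[OF dist[OF that]] set ..
    also have "\<dots> = of_int (minor_sum A rs ks)"
      by (rule measure_zonotope_on_unit_ext[OF drs that zero])
    also have "minor_sum A rs ks = minor_sum cols ?N ks"
      unfolding rs_def by (rule minor_sum_map) (rule A)
    finally show ?thesis .
  qed
  have modular: "two_modular (W ?N)"
    unfolding W_def
  proof (rule two_modular_map[OF dist])
    fix B assume B: "B \<subseteq> set (map Inl es @ map Inr ?N)" "card B = CARD('d)"
    show "abs_det (unit_ext A) B \<in> {0, 1, 2}"
    proof (rule abs_det_unit_ext_cases[OF drs _ zero B[unfolded set]])
      fix ts us
      assume l: "ts \<in> set (subseqs rs)" "us \<in> set (subseqs ?N)" "length ts = length us"
        and det: "abs_det (unit_ext A) B = of_int \<bar>minor A ts us\<bar>"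
      obtain ps where ps: "ts = map r ps" "ps \<in> set (subseqs ?N)"
        using l(1) unfolding rs_def subseqs_map set_map by blast
      have "set ps \<in> Pow (set ?N)" using ps(2) unfolding subseqs_powset[symmetric] by blast
      then have "minor A ts us = minor cols ps us"
        unfolding ps(1) using l(3) ps(1) A by (intro minor_map) auto
      then have "\<bar>minor A ts us\<bar> \<le> 2" using minor_cols ps l(2,3) by (metis length_map)
      then have "\<bar>minor A ts us\<bar> \<in> {0, 1, 2}" by auto
      then show ?thesis unfolding det by auto
    qed simp_all
  qed simp
  define V where "V = W [0, 1]"
  define w where "w = unit_ext A (Inr 2)"
  define w' where "w' = unit_ext A (Inr 3)"
  have V: "V @ [w] = W [0, 1, 2]" "V @ [w'] = W [0, 1, 3]" "V @ [w, w'] = W ?N"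
    unfolding V_def w_def w'_def W_def by simp_all
  have "measure lebesgue (zonotope (W [0, 1])) = 14"
    "measure lebesgue (zonotope (W [0, 1, 2])) = 30"
    "measure lebesgue (zonotope (W [0, 1, 3])) = 26"
    "measure lebesgue (zonotope (W ?N)) = 56"
    using vol[of "[0, 1]"] vol[of "[0, 1, 2]"] vol[of "[0, 1, 3]"] vol[of ?N]
    unfolding minor_sum_cols by simp_all
  then have "measure lebesgue (zonotope V) * measure lebesgue (zonotope (V @ [w, w']))
      > measure lebesgue (zonotope (V @ [w])) * measure lebesgue (zonotope (V @ [w']))"
    unfolding V unfolding V_def by simp
  moreover have "two_modular (V @ [w, w'])" unfolding V by (rule modular)
  moreover have "length V \<ge> 1" unfolding V_def W_def by simp
  ultimately show ?thesis by blast
qed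

end
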